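(* Let $\lambda$ be a nonzero real number and let $Y$ be uniformly distributed on $[0,1]$. Then for all integers $n\ge0$, \[ S_{n,\lambda}^{Y}(x)=\sum_{k=0}^{n}\binom{n}{k}\beta_{k,\lambda}(x)\,\frac{(-\lambda)^{n-k}(n-k)!}{n-k+1}. \]
   Context: For a nonzero real $\lambda$ and any $x$, set $(x)_{0,\lambda}=1$ and $(x)_{n,\lambda}=x(x-\lambda)\cdots(x-(n-1)\lambda)$ for $n\ge1$, $e_{\lambda}^{x}(t)=\sum_{k\ge0}(x)_{k,\lambda}\frac{t^k}{k!}=(1+\lambda t)^{x/\lambda}$, $e_\lambda(t)=e_\lambda^1(t)$. Degenerate Bernoulli polynomials: $\frac{t}{e_\lambda(t)-1}e_\lambda^x(t)=\sum_{n\ge0}\beta_{n,\lambda}(x)\frac{t^n}{n!}$. For a random variable $Y$ whose moment generating function exists near $0$, the degenerate Sheffer polynomials associated with $Y$ are defined by $\frac{1}{E[e_\lambda^{Y}(t)]}\,e_\lambda^x(t)=\sum_{n\ge0}S_{n,\lambda}^{Y}(x)\frac{t^n}{n!}$, where $E[e_\lambda^Y(t)]=E[(1+\lambda t)^{Y/\lambda}]$. *)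

theory Defs
  imports "HOL-Probability.Probability" "HOL-Computational_Algebra.Formal_Power_Series"
begin

definition degenerate_falling_factorial :: "real \<Rightarrow> real \<Rightarrow> nat \<Rightarrow> real" where
  "degenerate_falling_factorial lam x n = (\<Prod>i<n. x - real i * lam)"

definition degenerate_exp_fps :: "real \<Rightarrow> real \<Rightarrow> real fps" where
  "degenerate_exp_fps lam x = Abs_fps (\<lambda>k. degenerate_falling_factorial lam x k / fact k)"

definition degenerate_exp :: "real \<Rightarrow> real \<Rightarrow> real \<Rightarrow> real" where
  "degenerate_exp lam x t = eval_fps (degenerate_exp_fps lam x) t"

lemma degenerate_falling_factorial_gchoose:
  assumes "lam \<noteq> 0"
  shows "degenerate_falling_factorial lam x k / fact k = ((x / lam) gchoose k) * lam ^ k"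
proof -
  have "(\<Prod>i<k. x - real i * lam) = (\<Prod>i<k. lam * (x / lam - real i))"
    using assms by (intro prod.cong) (auto simp: field_simps)
  also have "\<dots> = lam ^ k * (\<Prod>i<k. x / lam - real i)"
    by (simp add: prod.distrib)
  finally show ?thesis
    by (simp add: degenerate_falling_factorial_def gbinomial_prod_rev lessThan_atLeast0)
qed

lemma degenerate_exp_eq_powr:
  assumes "lam \<noteq> 0" "\<bar>lam * t\<bar> < 1"
  shows "degenerate_exp lam x t = (1 + lam * t) powr (x / lam)"
  using gen_binomial_real[OF assms(2), of "x / lam"] assms(1)
  by (simp add: degenerate_exp_def eval_fps_def degenerate_exp_fps_def
      degenerate_falling_factorial_gchoose sums_iff power_mult_distrib mult_ac)

(* The denominator has vanishing constant term, so the quotient uses the division of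
   formal power series, which cancels the common factor fps_X. *)
definition degenerate_bernoulli :: "real \<Rightarrow> nat \<Rightarrow> real \<Rightarrow> real" where
  "degenerate_bernoulli lam n x =
     fact n * fps_nth (fps_X / (degenerate_exp_fps lam 1 - 1) * degenerate_exp_fps lam x) n"

(* The power series at 0 of the function mapping t to the expected value of
   degenerate_exp lam Y t; it is unspecified if that function has no expansion at 0. *)
definition degenerate_mgf_fps :: "'a measure \<Rightarrow> ('a \<Rightarrow> real) \<Rightarrow> real \<Rightarrow> real fps" where
  "degenerate_mgf_fps M Y lam =
     (THE F. (\<lambda>t. \<integral>\<omega>. degenerate_exp lam (Y \<omega>) t \<partial>M) has_fps_expansion F)"

definition degenerate_sheffer ::
    "'a measure \<Rightarrow> ('a \<Rightarrow> real) \<Rightarrow> real \<Rightarrow> nat \<Rightarrow> real \<Rightarrow> real" where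
  "degenerate_sheffer M Y lam n x =
     fact n * fps_nth (1 / degenerate_mgf_fps M Y lam * degenerate_exp_fps lam x) n"

lemma has_fps_expansion_unique_real:
  fixes F G :: "real fps"
  assumes "f has_fps_expansion F" "f has_fps_expansion G"
  shows "F = G"
proof (rule ccontr)
  assume ne: "F \<noteq> G"
  define H where "H = F - G"
  have H0: "(\<lambda>_. 0) has_fps_expansion H"
    using has_fps_expansion_diff[OF assms] by (simp add: H_def)
  have "H \<noteq> 0" using ne by (simp add: H_def)
  define k where "k = subdegree H"
  define U where "U = fps_shift k H"
  have U0: "fps_nth U 0 \<noteq> 0"
    using \<open>H \<noteq> 0\<close> by (simp add: U_def k_def)
  have HU: "H = U * fps_X ^ k"
    by (simp add: U_def k_def subdegree_decompose[symmetric])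
  have rU: "fps_conv_radius U > 0"
    using H0 by (simp add: U_def has_fps_expansion_def)
  have ev: "eventually (\<lambda>z. eval_fps U z = 0) (at 0)"
  proof -
    have "eventually (\<lambda>z. eval_fps H z = 0) (at 0)"
      using H0 by (auto simp: has_fps_expansion_def eventually_at_filter elim: eventually_mono)
    moreover have "eventually (\<lambda>z::real. z \<in> eball 0 (fps_conv_radius U)) (at 0)"
      using rU by (intro eventually_at_in_open') (auto simp: zero_ereal_def)
    moreover have "eventually (\<lambda>z::real. z \<noteq> 0) (at 0)"
      by (simp add: eventually_at_filter)
    ultimately show ?thesis
    proof eventually_elim
      case (elim z)
      then have "eval_fps U z * z ^ k = 0"
        by (simp add: HU eval_fps_mult fps_conv_radius_def[symmetric] eval_fps_power)
      then show ?case using elim by simp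
    qed
  qed
  have "isCont (eval_fps U) 0"
    using continuous_eval_fps[of 0 U UNIV] rU by (simp add: zero_ereal_def)
  then have "(eval_fps U \<longlongrightarrow> fps_nth U 0) (at 0)"
    by (simp add: isCont_def eval_fps_at_0)
  moreover have "(eval_fps U \<longlongrightarrow> 0) (at 0)"
    using ev by (simp add: tendsto_eventually)
  ultimately show False
    using U0 tendsto_unique[OF trivial_limit_at] by blast
qed

end

theory Submission
  imports Defs
begin

text \<open>For uniform \<open>Y\<close>, integrating \<open>y \<mapsto> (1 + \<lambda>t) powr (y / \<lambda>)\<close> over the unit interval gives
  \<open>\<lambda> (e(t) - 1) / ln (1 + \<lambda>t)\<close> with \<open>e = e\<^sub>\<lambda>\<close>. Hence the Sheffer generating function factors as
  \<open>ln (1 + \<lambda>t) / (\<lambda>t)\<close> times the Bernoulli generating function \<open>t e\<^sup>x(t) / (e(t) - 1)\<close>, and the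
  claim is the Cauchy product of the two series.\<close>

text \<open>The moment generating function of the uniform law; \<open>exp (c * y) / c\<close> is an
  antiderivative when \<open>c\<close> is nonzero.\<close>

lemma integral_uniform_measure_Icc_exp:
  fixes c :: real
  shows "(\<integral>y. exp (c * y) \<partial>uniform_measure lborel {0..1}) = (if c = 0 then 1 else (exp c - 1) / c)"
proof -
  \<comment> \<open>The unit interval has Lebesgue measure 1, so the normalising factor
    disappears.\<close>
  have "uniform_measure lborel {0..1::real} = density lborel (\<lambda>y. ennreal (indicator {0..1} y))"
    by (simp add: uniform_measure_def ennreal_indicator divide_ennreal_def)
  then have "(\<integral>y. exp (c * y) \<partial>uniform_measure lborel {0..1}) = (\<integral>y. indicator {0..1} y *\<^sub>R exp (c * y) \<partial>lborel)"
    by (simp add: integral_density)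
  also have "\<dots> = (if c = 0 then 1 else (exp c - 1) / c)"
  proof (cases "c = 0")
    case False
    have "(\<integral>y. indicator {0..1} y *\<^sub>R exp (c * y) \<partial>lborel) = exp (c * 1) / c - exp (c * 0) / c"
    proof (rule integral_FTC_atLeastAtMost)
      fix y :: real
      have "((\<lambda>y. exp (c * y) / c) has_field_derivative exp (c * y)) (at y within {0..1})"
        using False by (auto intro!: derivative_eq_intros)
      then show "((\<lambda>y. exp (c * y) / c) has_vector_derivative exp (c * y)) (at y within {0..1})"
        by (simp add: has_real_derivative_iff_has_vector_derivative)
    qed (auto intro!: continuous_intros)
    with False show ?thesis by (simp add: diff_divide_distrib)
  qed simp
  finally show ?thesis .
qed

lemma eventually_abs_mult_less_1:
  fixes c :: real
  shows "eventually (\<lambda>t. \<bar>c * t\<bar> < 1) (nhds 0)"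
proof -
  have "((\<lambda>t. \<bar>c * t\<bar>) \<longlongrightarrow> \<bar>c * 0\<bar>) (nhds 0)"
    by (rule tendsto_rabs[OF tendsto_mult[OF tendsto_const filterlim_ident]])
  then show ?thesis
    by (rule order_tendstoD(2)) simp
qed

lemma has_fps_expansion_one_plus_powr:
  assumes "lam \<noteq> 0"
  shows "(\<lambda>t. (1 + lam * t) powr (x / lam)) has_fps_expansion degenerate_exp_fps lam x"
proof (rule has_fps_expansionI)
  show "\<forall>\<^sub>F t in nhds 0. (\<lambda>n. fps_nth (degenerate_exp_fps lam x) n * t ^ n) sums (1 + lam * t) powr (x / lam)"
    using eventually_abs_mult_less_1[of lam]
  proof eventually_elim
    case (elim t)
    from gen_binomial_real[OF this, of "x / lam"] show ?case
      by (simp add: degenerate_exp_fps_def degenerate_falling_factorial_gchoose[OF assms]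
          power_mult_distrib mult_ac)
  qed
qed

text \<open>The Mercator series. Its missing constant term needs no case split, since division by
  \<open>real 0\<close> yields 0.\<close>

lemma has_fps_expansion_ln_one_plus_mult:
  fixes lam :: real
  shows "(\<lambda>t. ln (1 + lam * t)) has_fps_expansion Abs_fps (\<lambda>n. - ((- lam) ^ n / real n))"
proof (rule has_fps_expansionI)
  show "\<forall>\<^sub>F t in nhds 0. (\<lambda>n. fps_nth (Abs_fps (\<lambda>n. - ((- lam) ^ n / real n))) n * t ^ n) sums ln (1 + lam * t)"
    using eventually_abs_mult_less_1[of lam]
  proof eventually_elim
    case (elim t)
    have "(- (lam * t)) ^ k = (- lam) ^ k * t ^ k" for k
      by (simp only: mult_minus_left[symmetric] power_mult_distrib)
    with ln_series'[OF elim] show ?case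
      by simp
  qed
qed

text \<open>Side condition for dividing an expansion by \<open>t\<close>. The nonzero linear
  coefficient rules out the zero series, whose subdegree is 0 by convention.\<close>

lemma one_le_subdegree:
  assumes "fps_nth F 0 = 0" "fps_nth F 1 \<noteq> 0"
  shows "1 \<le> subdegree F"
proof (rule subdegree_geI)
  show "F \<noteq> 0" using assms(2) by auto
qed (use assms(1) in auto)

lemma degenerate_exp_fps_nth_0 [simp]: "fps_nth (degenerate_exp_fps lam x) 0 = 1"
  by (simp add: degenerate_exp_fps_def degenerate_falling_factorial_def)

lemma degenerate_exp_fps_nth_1 [simp]: "fps_nth (degenerate_exp_fps lam x) (Suc 0) = x"
  by (simp add: degenerate_exp_fps_def degenerate_falling_factorial_def)

lemma integral_degenerate_exp_uniform:
  assumes "lam \<noteq> 0" "\<bar>lam * t\<bar> < 1" "t \<noteq> 0"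
    and Y: "Y \<in> borel_measurable M" "distr M lborel Y = uniform_measure lborel {0..1}"
  shows "(\<integral>\<omega>. degenerate_exp lam (Y \<omega>) t \<partial>M) = lam * ((1 + lam * t) powr (1 / lam) - 1) / ln (1 + lam * t)"
proof -
  \<comment> \<open>With this \<open>c\<close>, \<open>exp (c * y)\<close> equals
    \<open>(1 + lam * t) powr (y / lam)\<close>, so the integral becomes the ordinary moment
    generating function at \<open>c\<close>.\<close>
  define c where "c = ln (1 + lam * t) / lam"
  have pos: "1 + lam * t > 0" using assms(2) by linarith
  have "c \<noteq> 0" using assms pos by (simp add: c_def)
  have "(\<integral>\<omega>. degenerate_exp lam (Y \<omega>) t \<partial>M) = (\<integral>\<omega>. exp (c * Y \<omega>) \<partial>M)"
    using assms pos by (simp add: degenerate_exp_eq_powr powr_def c_def mult_ac)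
  also have "\<dots> = (\<integral>y. exp (c * y) \<partial>distr M lborel Y)"
    using Y(1) by (subst integral_distr) auto
  also have "\<dots> = (exp c - 1) / c"
    using \<open>c \<noteq> 0\<close> by (simp add: Y(2) integral_uniform_measure_Icc_exp)
  also have "exp c = (1 + lam * t) powr (1 / lam)"
    using pos by (simp add: c_def powr_def)
  finally show ?thesis by (simp add: c_def mult_ac)
qed

text \<open>The closed form of the expectation is 0/0 at \<open>t = 0\<close>. Dividing numerator
  and denominator by \<open>t\<close> leaves \<open>?B\<close> for \<open>(e(t) - 1) / t\<close> and
  \<open>?A\<close> for \<open>ln (1 + lam * t) / (lam * t)\<close>, both with constant term 1, so
  \<open>?A\<close> is invertible.\<close>

lemma degenerate_mgf_fps_uniform:
  fixes M :: "'a measure" and Y :: "'a \<Rightarrow> real" and lam :: real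
  assumes "lam \<noteq> 0" "prob_space M"
    and Y: "Y \<in> borel_measurable M" "distr M lborel Y = uniform_measure lborel {0..1}"
  shows "degenerate_mgf_fps M Y lam =
    fps_shift 1 (degenerate_exp_fps lam 1 - 1) * inverse (Abs_fps (\<lambda>n. (- lam) ^ n / (real n + 1)))"
    (is "_ = ?B * inverse ?A")
proof -
  interpret prob_space M by fact
  let ?e = "\<lambda>t. (1 + lam * t) powr (1 / lam)"
  let ?L = "Abs_fps (\<lambda>n. - ((- lam) ^ n / real n))"
  \<comment> \<open>The value at 0 is the linear coefficient of the unshifted series: 1 here, and
    \<open>lam\<close> for the logarithm below.\<close>
  have B: "(\<lambda>t. if t = 0 then 1 else (?e t - 1) / t ^ 1) has_fps_expansion ?B"
    by (intro has_fps_expansion_shift has_fps_expansion_diff has_fps_expansion_one_plus_powr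
        has_fps_expansion_1 one_le_subdegree assms) auto
  have "(\<lambda>t. if t = 0 then lam else ln (1 + lam * t) / t ^ 1) has_fps_expansion fps_shift 1 ?L"
    by (intro has_fps_expansion_shift has_fps_expansion_ln_one_plus_mult one_le_subdegree)
      (use assms in auto)
  then have "(\<lambda>t. inverse lam * (if t = 0 then lam else ln (1 + lam * t) / t ^ 1))
      has_fps_expansion fps_const (inverse lam) * fps_shift 1 ?L"
    by (rule has_fps_expansion_cmult_left)
  also have "fps_const (inverse lam) * fps_shift 1 ?L = ?A"
    using assms(1) by (intro fps_ext) (simp add: field_simps)
  finally have A: "(\<lambda>t. inverse lam * (if t = 0 then lam else ln (1 + lam * t) / t ^ 1))
      has_fps_expansion ?A" .
  have "(\<lambda>t. (if t = 0 then 1 else (?e t - 1) / t ^ 1) *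
      inverse (inverse lam * (if t = 0 then lam else ln (1 + lam * t) / t ^ 1)))
      has_fps_expansion ?B * inverse ?A" (is "?f has_fps_expansion _")
    by (intro has_fps_expansion_mult has_fps_expansion_inverse A B) simp
  moreover have "\<forall>\<^sub>F t in nhds 0. (\<integral>\<omega>. degenerate_exp lam (Y \<omega>) t \<partial>M) = ?f t"
    using eventually_abs_mult_less_1[of lam]
  proof eventually_elim
    case (elim t)
    show ?case
    \<comment> \<open>The closed form excludes \<open>t = 0\<close>; there the integrand is 1 and
      the integral is the total mass 1, which agrees with \<open>?f 0\<close>.\<close>
    proof (cases "t = 0")
      case True
      with assms show ?thesis by (simp add: degenerate_exp_eq_powr prob_space)
    next
      case False
      with elim assms show ?thesis
        by (simp add: integral_degenerate_exp_uniform field_simps)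
    qed
  qed
  ultimately have "(\<lambda>t. \<integral>\<omega>. degenerate_exp lam (Y \<omega>) t \<partial>M) has_fps_expansion ?B * inverse ?A"
    by (auto simp: has_fps_expansion_def elim: eventually_elim2)
  then show ?thesis
    unfolding degenerate_mgf_fps_def
    by (intro the_equality) (auto intro: has_fps_expansion_unique_real)
qed

theorem theorem3p3:
  fixes M :: "'a measure" and Y :: "'a \<Rightarrow> real" and lam x :: real and n :: nat
  assumes "lam \<noteq> 0"
    and "prob_space M"
    and "Y \<in> borel_measurable M"
    and "distr M lborel Y = uniform_measure lborel {0..1}"
  shows "degenerate_sheffer M Y lam n x =
    (\<Sum>k=0..n. real (n choose k) * degenerate_bernoulli lam k x *
       ((- lam) ^ (n - k) * fact (n - k) / (real (n - k) + 1)))"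
proof -
  \<comment> \<open>\<open>fact j\<close> times coefficient \<open>j\<close> of \<open>A\<close> is
    the weight in the claim with \<open>j = n - k\<close>, while \<open>G\<close> will be the
    Bernoulli generating function.\<close>
  define A where "A = Abs_fps (\<lambda>n. (- lam) ^ n / (real n + 1))"
  define B where "B = fps_shift 1 (degenerate_exp_fps lam 1 - 1)"
  define G where "G = inverse B * degenerate_exp_fps lam x"
  have A0: "fps_nth A 0 \<noteq> 0" and B0: "fps_nth B 0 \<noteq> 0"
    by (simp_all add: A_def B_def)
  have "1 / degenerate_mgf_fps M Y lam = inverse (B * inverse A)"
    using A0 B0
    by (simp add: degenerate_mgf_fps_uniform[OF assms, folded A_def B_def] fps_divide_unit)
  then have sheffer: "1 / degenerate_mgf_fps M Y lam * degenerate_exp_fps lam x = G * A"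
    using A0 by (simp add: fps_inverse_mult fps_inverse_idempotent G_def mult_ac)
  \<comment> \<open>\<open>degenerate_exp_fps lam 1 - 1\<close> is not a unit; splitting off
    \<open>fps_X\<close> lets it cancel and leaves division by the unit \<open>B\<close>.\<close>
  have XB: "degenerate_exp_fps lam 1 - 1 = B * fps_X"
    by (simp add: B_def fps_eq_iff)
  have "fps_X / (degenerate_exp_fps lam 1 - 1) = (1 * fps_X) / (B * fps_X)"
    by (simp add: XB)
  also have "\<dots> = inverse B"
    using B0 by (subst div_mult_mult2) (simp_all add: fps_divide_unit)
  finally have bernoulli: "degenerate_bernoulli lam k x = fact k * fps_nth G k" for k
    by (simp add: degenerate_bernoulli_def G_def)
  show ?thesis
    unfolding degenerate_sheffer_def sheffer fps_mult_nth sum_distrib_left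
  proof (rule sum.cong[OF refl])
    fix k assume "k \<in> {0..n}"
    \<comment> \<open>The binomial coefficient turns the ordinary Cauchy product into the
      exponential one.\<close>
    then have "(fact n :: real) = fact k * fact (n - k) * real (n choose k)"
      using binomial_fact_lemma[of k n] by (metis atLeastAtMost_iff of_nat_fact of_nat_mult)
    then show "fact n * (fps_nth G k * fps_nth A (n - k)) =
        real (n choose k) * degenerate_bernoulli lam k x *
        ((- lam) ^ (n - k) * fact (n - k) / (real (n - k) + 1))"
      by (simp add: bernoulli A_def)
  qed
qed

end
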